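(* Let $V$ be a vertex set with $|V|=n\ge 2$ and let $G$ be the disjoint union of $k$ spanning arborescences $A_1,\dots,A_k$ on $V$. If $k\ge 2n-3$, then $G$ has a rainbow spanning arborescence. Furthermore, if $n\ge 3$ and $k\ge 2n-4$, then $G$ has a rainbow spanning arborescence.
   Context: An arborescence is a connected digraph in which exactly one vertex (the root) has no incoming arc and every other vertex has exactly one incoming arc; it is spanning on $V$ if its vertex set is $V$. $G$ is the disjoint union of the arc sets $A_i$ (parallel arcs of different indices allowed). A subgraph $B$ of $G$ is rainbow if $|B\cap A_i|\le 1$ for all $i\in[k]$. *)

theory Defs
  imports "Graph_Theory.Graph_Theory"
begin

text \<open>
  Connectedness is that of the underlying undirected graph. Since \<^const>\<open>in_degree\<close> is a \<^const>\<open>card\<close>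
  and hence \<open>0\<close> on infinite sets, having no incoming arc is expressed by an empty \<^const>\<open>in_arcs\<close>.
\<close>

definition arborescence :: "('a, 'b) pre_digraph \<Rightarrow> bool" where
  "arborescence T \<longleftrightarrow> wf_digraph T \<and> Digraph_Component.connected T \<and>
     (\<exists>!r. r \<in> verts T \<and> in_arcs T r = {}) \<and>
     (\<forall>v\<in>verts T. in_arcs T v \<noteq> {} \<longrightarrow> in_degree T v = 1)"

definition spanning_arborescence_on :: "'a set \<Rightarrow> ('a, 'b) pre_digraph \<Rightarrow> bool" where
  "spanning_arborescence_on V T \<longleftrightarrow> arborescence T \<and> verts T = V"

text \<open>
  The union keeps the common vertex set \<open>V\<close>; only the arcs are made disjoint, by tagging each
  arc with the index of the digraph it comes from.
\<close>

definition arc_disjoint_union ::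
    "'a set \<Rightarrow> 'i set \<Rightarrow> ('i \<Rightarrow> ('a, 'b) pre_digraph) \<Rightarrow> ('a, 'i \<times> 'b) pre_digraph" where
  "arc_disjoint_union V I A =
     \<lparr> verts = V,
       arcs = (SIGMA i:I. arcs (A i)),
       tail = (\<lambda>(i, e). tail (A i) e),
       head = (\<lambda>(i, e). head (A i) e) \<rparr>"

text \<open>
  The set \<open>{i} \<times> arcs (A i)\<close> is the copy of the arc set of \<open>A i\<close> inside the disjoint union.
\<close>

definition rainbow :: "'i set \<Rightarrow> ('i \<Rightarrow> ('a, 'b) pre_digraph) \<Rightarrow> ('a, 'i \<times> 'b) pre_digraph \<Rightarrow> bool" where
  "rainbow I A B \<longleftrightarrow>
     (\<forall>i\<in>I. finite (arcs B \<inter> ({i} \<times> arcs (A i))) \<and> card (arcs B \<inter> ({i} \<times> arcs (A i))) \<le> 1)"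

definition has_rainbow_spanning_arborescence ::
    "'a set \<Rightarrow> 'i set \<Rightarrow> ('i \<Rightarrow> ('a, 'b) pre_digraph) \<Rightarrow> bool" where
  "has_rainbow_spanning_arborescence V I A \<longleftrightarrow>
     (\<exists>B. subgraph B (arc_disjoint_union V I A) \<and> spanning_arborescence_on V B \<and> rainbow I A B)"

end

theory Submission
  imports Defs
begin

text \<open>
  The only property of a spanning arborescence that is used is that every proper vertex subset
  containing its root is left by one of its arcs. Hence a rainbow out-tree can be extended by any
  unused colour rooted inside it. Let \<open>S\<close> be the vertex set of a largest rainbow out-tree and suppose
  \<open>S \<noteq> V\<close>; then no unused colour has an arc leaving \<open>S\<close>, so all of them are rooted in \<open>V - S\<close> and
  remain root-connected there. If \<open>V - S\<close> has at least two vertices, induction gives a rainbow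
  out-tree spanning \<open>V - S\<close> with unused colours, and enough of these are left to extend it to \<open>V\<close>.
  If \<open>V - S = {w}\<close>, all unused colours are rooted at \<open>w\<close>: either all colours are, and the tree can be
  grown from \<open>w\<close>, or some colour has an arc \<open>u \<rightarrow> w\<close>, which is extended by the unused colours.
\<close>

section \<open>Rainbow out-trees and root-connected colours\<close>

locale coloured_arcs =
  fixes src :: "'e \<Rightarrow> 'a" and tgt :: "'e \<Rightarrow> 'a" and col :: "'e \<Rightarrow> 'i"
begin

text \<open>Adding one leaf at a time, with a fresh head and a fresh colour, rules out cycles,
  double heads and repeated colours by construction. \<open>S\<close> is carried along because a
  one-vertex tree has no arc to show its vertex.\<close>

inductive rainbow_tree :: "'e set \<Rightarrow> 'a set \<Rightarrow> 'e set \<Rightarrow> bool" for E where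
  single: "rainbow_tree E {v} {}"
| extend: "rainbow_tree E S F \<Longrightarrow> e \<in> E \<Longrightarrow> src e \<in> S \<Longrightarrow> tgt e \<notin> S \<Longrightarrow> col e \<notin> col ` F
    \<Longrightarrow> rainbow_tree E (insert (tgt e) S) (insert e F)"

text \<open>This is the cut form of: every vertex of \<open>V\<close> can be reached from
  \<open>r\<close> by arcs of colour \<open>i\<close> inside \<open>V\<close>. A cut yields directly
  the arc that extends a tree.\<close>

definition root_connected :: "'a set \<Rightarrow> 'e set \<Rightarrow> 'i \<Rightarrow> 'a \<Rightarrow> bool" where
  "root_connected V E i r \<longleftrightarrow> r \<in> V \<and>
     (\<forall>S. S \<subset> V \<longrightarrow> r \<in> S \<longrightarrow> (\<exists>e\<in>E. col e = i \<and> src e \<in> S \<and> tgt e \<in> V - S))"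

lemma root_connectedE:
  assumes "root_connected V E i r" "S \<subseteq> V" "S \<noteq> V" "r \<in> S"
  obtains e where "e \<in> E" "col e = i" "src e \<in> S" "tgt e \<in> V" "tgt e \<notin> S"
  using assms unfolding root_connected_def by blast

text \<open>For \<open>U\<close> inside \<open>V - S\<close>, cut at \<open>U \<union> S\<close>:
  the arc leaving it cannot start in \<open>S\<close>, so it starts in \<open>U\<close>.\<close>

lemma root_connected_Diff:
  assumes rc: "root_connected V E i r" and S: "S \<subseteq> V" "r \<notin> S"
    and no_arc: "\<And>e. e \<in> E \<Longrightarrow> col e = i \<Longrightarrow> src e \<in> S \<Longrightarrow> tgt e \<in> V \<Longrightarrow> tgt e \<in> S"
  shows "root_connected (V - S) E i r"
  unfolding root_connected_def
proof (intro conjI allI impI)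
  show "r \<in> V - S" using rc S by (simp add: root_connected_def)
  fix U assume U: "U \<subset> V - S" "r \<in> U"
  then have "U \<union> S \<subseteq> V" "U \<union> S \<noteq> V" "r \<in> U \<union> S" using S by auto
  then obtain e where "e \<in> E" "col e = i" "src e \<in> U \<union> S" "tgt e \<in> V" "tgt e \<notin> U \<union> S"
    using rc by (elim root_connectedE)
  with no_arc[of e] show "\<exists>e\<in>E. col e = i \<and> src e \<in> U \<and> tgt e \<in> V - S - U" by auto
qed

lemma rainbow_tree_subset: "rainbow_tree E S F \<Longrightarrow> F \<subseteq> E"
  by (induction rule: rainbow_tree.induct) auto

lemma rainbow_tree_inj_on_col: "rainbow_tree E S F \<Longrightarrow> inj_on col F"
  by (induction rule: rainbow_tree.induct) (simp_all add: image_iff)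

lemma rainbow_tree_finite: "rainbow_tree E S F \<Longrightarrow> finite S \<and> finite F"
  by (induction rule: rainbow_tree.induct) auto

lemma rainbow_tree_card: "rainbow_tree E S F \<Longrightarrow> card S = Suc (card (col ` F))"
proof (induction rule: rainbow_tree.induct)
  case (extend S F e)
  then show ?case using rainbow_tree_finite[OF extend.hyps(1)] by simp
qed simp

lemma rainbow_tree_structure:
  assumes "rainbow_tree E S F"
  obtains r where "r \<in> S" "inj_on tgt F" "tgt ` F = S - {r}" "src ` F \<subseteq> S"
    "\<And>v. v \<in> S \<Longrightarrow> (r, v) \<in> {(src e, tgt e) | e. e \<in> F}\<^sup>*"
proof -
  have "\<exists>r\<in>S. inj_on tgt F \<and> tgt ` F = S - {r} \<and> src ` F \<subseteq> S \<and>
      (\<forall>v\<in>S. (r, v) \<in> {(src e, tgt e) | e. e \<in> F}\<^sup>*)"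
    using assms
  proof (induction rule: rainbow_tree.induct)
    case (extend S F e)
    let ?R = "\<lambda>F. {(src e, tgt e) | e. e \<in> F}"
    from extend.IH obtain r where r: "r \<in> S" "inj_on tgt F" "tgt ` F = S - {r}" "src ` F \<subseteq> S"
      and reach: "\<And>v. v \<in> S \<Longrightarrow> (r, v) \<in> (?R F)\<^sup>*" by auto
    have reach': "(r, v) \<in> (?R (insert e F))\<^sup>*" if "v \<in> S" for v
      using reach[OF that] by (rule rev_subsetD) (intro rtrancl_mono, auto)
    have "(r, tgt e) \<in> (?R (insert e F))\<^sup>*"
      by (rule rtrancl_into_rtrancl[OF reach'[OF \<open>src e \<in> S\<close>]]) blast
    moreover have "tgt e \<notin> tgt ` F" "tgt e \<noteq> r" using r extend.hyps(4) by auto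
    moreover have "tgt ` insert e F = insert (tgt e) S - {r}"
      using r(3) \<open>tgt e \<noteq> r\<close> by (simp add: insert_Diff_if)
    moreover have "inj_on tgt (insert e F)"
      using \<open>inj_on tgt F\<close> \<open>tgt e \<notin> tgt ` F\<close> by auto
    moreover have "src ` insert e F \<subseteq> insert (tgt e) S" using r(4) extend.hyps(3) by auto
    moreover have "\<forall>v\<in>insert (tgt e) S. (r, v) \<in> (?R (insert e F))\<^sup>*"
      using reach' \<open>(r, tgt e) \<in> (?R (insert e F))\<^sup>*\<close> by blast
    ultimately show ?case using \<open>r \<in> S\<close> by blast
  qed simp
  then show thesis by (elim bexE conjE) (rule that, assumption+, erule (1) bspec)
qed

section \<open>Growing rainbow trees and the extremal argument\<close>

lemma rainbow_tree_grow:
  assumes "rainbow_tree E S F" "S \<subseteq> V" "finite V" "finite D" "D \<inter> col ` F = {}"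
    and "\<And>i. i \<in> D \<Longrightarrow> \<exists>r\<in>S. root_connected V E i r"
    and "card (V - S) \<le> card D"
  shows "\<exists>F'. rainbow_tree E V F' \<and> col ` F' \<subseteq> col ` F \<union> D"
  using assms
proof (induction "card (V - S)" arbitrary: S F D)
  case 0
  then have "S = V" by auto
  with 0 show ?case by auto
next
  case (Suc m)
  then have "S \<noteq> V" "D \<noteq> {}" by auto
  \<comment> \<open>The order of the colours is irrelevant: a root in \<open>S\<close> stays inside
    every larger tree, so each colour of \<open>D\<close> can supply one arc.\<close>
  then obtain i where i: "i \<in> D" by blast
  with Suc.prems obtain r where "r \<in> S" "root_connected V E i r" by blast
  with \<open>S \<noteq> V\<close> \<open>S \<subseteq> V\<close> obtain e where e: "e \<in> E" "col e = i" "src e \<in> S" "tgt e \<in> V" "tgt e \<notin> S"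
    by (elim root_connectedE)
  let ?S = "insert (tgt e) S" and ?F = "insert e F"
  have "rainbow_tree E ?S ?F"
    using Suc.prems(1,5) e i by (intro extend) auto
  moreover have m: "m = card (V - ?S)"
    using Suc.hyps(2) e \<open>finite V\<close> by (subst Diff_insert) simp
  moreover have "card (V - ?S) \<le> card (D - {i})"
    using m Suc.hyps(2) Suc.prems(4,7) i by simp
  moreover have "(D - {i}) \<inter> col ` ?F = {}" using Suc.prems(5) e by auto
  moreover have "\<exists>r\<in>?S. root_connected V E j r" if "j \<in> D - {i}" for j
    using Suc.prems(6)[of j] that by blast
  ultimately have "\<exists>F'. rainbow_tree E V F' \<and> col ` F' \<subseteq> col ` ?F \<union> (D - {i})"
    using \<open>S \<subseteq> V\<close> \<open>tgt e \<in> V\<close> \<open>finite V\<close> \<open>finite D\<close> by (intro Suc.hyps(1)) simp_all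
  moreover have "col ` ?F \<union> (D - {i}) = col ` F \<union> D" using e i by auto
  ultimately show ?case by simp
qed

text \<open>With n vertices and k colours the bounds say k \<ge> n - 1 and k \<ge> 2n - 4. The first
  is decisive for n = 2, a size that can occur for \<open>V - S\<close> in the induction.\<close>

lemma rainbow_tree_exists:
  assumes "finite V" "V \<noteq> {}" "finite I"
    and "\<And>i. i \<in> I \<Longrightarrow> \<exists>r. root_connected V E i r"
    and "card V \<le> card I + 1" "2 * card V \<le> card I + 4"
  shows "\<exists>F. rainbow_tree E V F \<and> col ` F \<subseteq> I"
  using assms
proof (induction "card V" arbitrary: V I rule: less_induct)
  case less
  note fin = less.prems(1) and finI = less.prems(3) and rc = less.prems(4)
    and card1 = less.prems(5) and card2 = less.prems(6)
  define P where
    "P = (\<lambda>(S, F). rainbow_tree E S F \<and> S \<subseteq> V \<and> col ` F \<subseteq> I)"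
  obtain v where "v \<in> V" using less.prems(2) by blast
  then have "P ({v}, {})" by (simp add: P_def single)
  moreover have "\<forall>y. P y \<longrightarrow> card (fst y) < Suc (card V)"
    using fin by (auto simp: P_def less_Suc_eq_le intro: card_mono)
  ultimately obtain x where "P x" and "\<forall>y. P y \<longrightarrow> card (fst y) \<le> card (fst x)"
    using ex_has_greatest_nat[of P "({v}, {})" "\<lambda>y. card (fst y)"] by blast
  moreover obtain S F where "x = (S, F)" by (cases x)
  ultimately have tree: "rainbow_tree E S F" and SV: "S \<subseteq> V" and FI: "col ` F \<subseteq> I"
    and max: "\<And>S' F'. rainbow_tree E S' F' \<Longrightarrow> S' \<subseteq> V \<Longrightarrow> col ` F' \<subseteq> I \<Longrightarrow> card S' \<le> card S"
    by (auto simp: P_def)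
  have finS: "finite S" and cardS: "card S = Suc (card (col ` F))"
    using rainbow_tree_finite[OF tree] rainbow_tree_card[OF tree] by auto
  define D where "D = I - col ` F"
  have finD: "finite D" using finI by (simp add: D_def)
  have "card I = card D + card (col ` F)"
    using FI finI by (simp add: D_def card_Diff_subset finite_subset card_mono)
  \<comment> \<open>The tree uses one colour fewer than it has vertices; all later counts rest on
    this.\<close>
  with cardS have cardI: "card I + 1 = card D + card S" by simp
  have closed: "tgt e \<in> S" if "e \<in> E" "col e \<in> D" "src e \<in> S" "tgt e \<in> V" for e
  proof (rule ccontr)
    assume "tgt e \<notin> S"
    with that tree have "rainbow_tree E (insert (tgt e) S) (insert e F)"
      by (intro extend) (auto simp: D_def)
    from max[OF this] \<open>tgt e \<notin> S\<close> that SV FI finS show False by (auto simp: D_def)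
  qed
  show ?case
  proof (cases "S = V")
    case True
    with tree FI show ?thesis by blast
  next
    case False
    have outside: "r \<notin> S" if "i \<in> D" "root_connected V E i r" for i r
      using that closed SV False by (metis root_connectedE)
    have cardVS: "card (V - S) = card V - card S" "card S \<le> card V"
      using SV fin finS by (auto simp: card_Diff_subset card_mono)
    have "V - S \<noteq> {}" using SV False by blast
    then have "card (V - S) \<noteq> 0" using fin by simp
    with cardVS have lt: "card S < card V" by simp
    show ?thesis
    proof (cases "card (V - S) = 1")
      case True
      then obtain w where w: "V - S = {w}" by (rule card_1_singletonE)
      then have wV: "w \<in> V" "w \<notin> S" by auto
      show ?thesis
      proof (cases "\<forall>i\<in>I. root_connected V E i w")
        case True
        have "\<exists>F. rainbow_tree E V F \<and> col ` F \<subseteq> col ` {} \<union> I"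
          using fin finI wV card1 True
          by (intro rainbow_tree_grow[OF single[of _ w]]) auto
        then show ?thesis by simp
      next
        case False
        then obtain i r where i: "i \<in> I" and r: "root_connected V E i r" "r \<noteq> w" using rc by metis
        have rV: "r \<in> V" using r(1) by (simp add: root_connected_def)
        with r w have "r \<in> S" by blast
        with r i outside have iD: "i \<notin> D" by blast
        \<comment> \<open>As \<open>r\<close> lies in \<open>V - {w}\<close>, this cut forces an arc
          of colour \<open>i\<close> into \<open>w\<close>. Colour \<open>i\<close> is already used
          in \<open>F\<close>, so starting a new tree with it leaves all of \<open>D\<close>
          available.\<close>
        obtain e where e: "e \<in> E" "col e = i" "src e \<in> V - {w}" "tgt e = w"
          by (rule root_connectedE[OF r(1), of "V - {w}"]) (use rV r(2) wV in auto)
        have "rainbow_tree E (insert (tgt e) {src e}) (insert e {})"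
          using e by (intro extend single) auto
        then have "rainbow_tree E {w, src e} {e}" using e by simp
        moreover have "\<exists>r\<in>{w, src e}. root_connected V E j r" if j: "j \<in> D" for j
        proof -
          obtain q where q: "root_connected V E j q" using j rc unfolding D_def by blast
          then have "q \<in> V" by (simp add: root_connected_def)
          with outside[OF j q] w have "q = w" by blast
          with q show ?thesis by simp
        qed
        moreover have "card (V - {w, src e}) \<le> card D"
        proof -
          have "card (V - {w, src e}) = card V - 2"
            using e wV by (subst card_Diff_subset) auto
          \<comment> \<open>Here |S| = n - 1, so |D| = k - n + 2 \<ge> n - 2: the bound 2n - 4 is
            exactly what this needs.\<close>
          then show ?thesis using True cardVS cardI card2 lt by linarith
        qed
        ultimately have "\<exists>F'. rainbow_tree E V F' \<and> col ` F' \<subseteq> col ` {e} \<union> D"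
          using fin finD e iD wV by (intro rainbow_tree_grow) auto
        moreover have "col ` {e} \<union> D \<subseteq> I" using e i by (simp add: D_def)
        ultimately show ?thesis by (meson order_trans)
      qed
    next
      case False
      with \<open>card (V - S) \<noteq> 0\<close> cardVS have lt2: "card S + 2 \<le> card V" by simp
      have S1: "card S \<ge> 1" using cardS by simp
      have "\<exists>F'. rainbow_tree E (V - S) F' \<and> col ` F' \<subseteq> D"
      proof (rule less.hyps)
        show "card (V - S) < card V" using cardVS S1 lt by simp
        show "\<exists>r. root_connected (V - S) E i r" if i: "i \<in> D" for i
        proof -
          obtain r where r: "root_connected V E i r" using i rc unfolding D_def by blast
          have "root_connected (V - S) E i r"
            using r SV outside[OF i r] closed i by (intro root_connected_Diff) auto
          then show ?thesis ..
        qed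
        \<comment> \<open>Removing s = |S| \<ge> 1 vertices costs only s - 1 colours, while the
          second bound drops by 2s.\<close>
        show "card (V - S) \<le> card D + 1" "2 * card (V - S) \<le> card D + 4"
          using cardVS cardI card2 lt2 S1 by linarith+
      qed (use fin finD \<open>V - S \<noteq> {}\<close> in auto)
      then obtain F' where F': "rainbow_tree E (V - S) F'" "col ` F' \<subseteq> D" by blast
      have "card (D - col ` F') = card D - card (col ` F')"
        using F'(2) finD by (meson card_Diff_subset finite_subset)
      moreover have "card (V - S) = Suc (card (col ` F'))" by (rule rainbow_tree_card[OF F'(1)])
      moreover have "V - (V - S) = S" using SV by blast
      \<comment> \<open>There remain k + 1 - s - (n - s - 1) = k + 2 - n \<ge> n - 2 colours, and n
        - 2 \<ge> s because \<open>V - S\<close> has at least two vertices.\<close>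
      ultimately have le: "card (V - (V - S)) \<le> card (D - col ` F')"
        using cardVS cardI card2 lt2 by simp
      have "\<exists>r\<in>V - S. root_connected V E i r" if i: "i \<in> D - col ` F'" for i
      proof -
        obtain r where r: "root_connected V E i r" using i rc unfolding D_def by blast
        then show ?thesis using outside i by (auto simp: root_connected_def)
      qed
      then have "\<exists>F''. rainbow_tree E V F'' \<and> col ` F'' \<subseteq> col ` F' \<union> (D - col ` F')"
        using F' fin finD le by (intro rainbow_tree_grow) auto
      moreover have "col ` F' \<union> (D - col ` F') \<subseteq> I" using F'(2) unfolding D_def by blast
      ultimately show ?thesis by (meson order_trans)
    qed
  qed
qed

section \<open>Translation between rainbow trees and arborescences\<close>

lemma rainbow_tree_arborescence:
  assumes "rainbow_tree E S F"
  shows "spanning_arborescence_on S \<lparr>verts = S, arcs = F, tail = src, head = tgt\<rparr>"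
    (is "spanning_arborescence_on S ?B")
proof -
  obtain r where r: "r \<in> S" and inj: "inj_on tgt F" and tgt: "tgt ` F = S - {r}"
    and src: "src ` F \<subseteq> S"
    and reach: "\<And>v. v \<in> S \<Longrightarrow> (r, v) \<in> {(src e, tgt e) | e. e \<in> F}\<^sup>*"
    using assms by (rule rainbow_tree_structure) blast
  have wf: "wf_digraph ?B" using src tgt by unfold_locales auto
  then interpret B: wf_digraph ?B .
  have arcs_eq: "arcs_ends ?B = {(src e, tgt e) | e. e \<in> F}"
    by (auto simp: arcs_ends_def arc_to_ends_def)
  have from_root: "r \<rightarrow>\<^sup>*\<^bsub>mk_symmetric ?B\<^esub> v" if "v \<in> S" for v
  proof -
    have "(r, v) \<in> (arcs_ends ?B)\<^sup>*" using reach[OF that] by (simp only: arcs_eq)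
    then have "r \<rightarrow>\<^sup>*\<^bsub>?B\<^esub> v"
    proof (induction rule: rtrancl_induct)
      case base
      show ?case using r by simp
    next
      case (step u w)
      then show ?case by (auto intro: B.reachable_adj_trans)
    qed
    then show ?thesis by (rule B.reachable_mk_symmetricI)
  qed
  \<comment> \<open>Any two vertices are joined through the root in the symmetric closure.\<close>
  have "Digraph_Component.connected ?B"
  proof (rule B.connectedI)
    interpret M: pair_wf_digraph "mk_symmetric ?B" ..
    fix u v assume "u \<in> verts ?B" "v \<in> verts ?B"
    then have "r \<rightarrow>\<^sup>*\<^bsub>mk_symmetric ?B\<^esub> u" "r \<rightarrow>\<^sup>*\<^bsub>mk_symmetric ?B\<^esub> v"
      using from_root by auto
    then show "u \<rightarrow>\<^sup>*\<^bsub>mk_symmetric ?B\<^esub> v"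
      by (meson M.reachable_trans symmetric_mk_symmetric symmetric_reachable)
  qed (use r in auto)
  moreover have "in_arcs ?B v = {} \<longleftrightarrow> v = r" if "v \<in> S" for v
  proof -
    have "in_arcs ?B v = {} \<longleftrightarrow> v \<notin> tgt ` F" by auto
    then show ?thesis using that by (simp add: tgt)
  qed
  moreover have "in_degree ?B v = 1" if "in_arcs ?B v \<noteq> {}" for v
  proof -
    have "\<exists>e\<in>F. tgt e = v" using that by (auto simp: in_arcs_def)
    then obtain e where "e \<in> F" "tgt e = v" by blast
    then have "in_arcs ?B v = {e}" using inj by (auto dest: inj_onD)
    then show ?thesis by (simp add: in_degree_def)
  qed
  ultimately show ?thesis
    using wf r unfolding spanning_arborescence_on_def arborescence_def by auto
qed

end

text \<open>
  In-degree one makes the set of vertices reachable from the root closed under arcs in both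
  directions, so by connectedness it is everything.
\<close>

lemma arborescence_cut:
  assumes "arborescence T"
  shows "\<exists>r\<in>verts T. \<forall>S. S \<subset> verts T \<longrightarrow> r \<in> S \<longrightarrow>
    (\<exists>e\<in>arcs T. tail T e \<in> S \<and> head T e \<in> verts T - S)"
proof -
  interpret wf_digraph T using assms by (simp add: arborescence_def)
  obtain r where r: "r \<in> verts T" "in_arcs T r = {}"
    using assms by (auto simp: arborescence_def)
  have deg: "in_degree T v = 1" if "v \<in> verts T" "in_arcs T v \<noteq> {}" for v
    using assms that by (auto simp: arborescence_def)
  have conn: "r \<rightarrow>\<^sup>*\<^bsub>mk_symmetric T\<^esub> v" if "v \<in> verts T" for v
    using assms that r by (auto simp: arborescence_def connected_def strongly_connected_def)
  let ?R = "{(tail T e, head T e) | e. e \<in> arcs T}"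
  have sym: "(r, tail T e) \<in> ?R\<^sup>*" if e: "e \<in> arcs T" and reach: "(r, head T e) \<in> ?R\<^sup>*" for e
  proof -
    have in_e: "e \<in> in_arcs T (head T e)" using e by simp
    then have "head T e \<noteq> r" using r by auto
    \<comment> \<open>The path to the head of \<open>e\<close> is nonempty; its last arc
      \<open>f\<close> must be \<open>e\<close>, the only arc into that head, so dropping it leaves
      a path to the tail of \<open>e\<close>.\<close>
    with reach obtain f where f: "f \<in> arcs T" "(r, tail T f) \<in> ?R\<^sup>*" "head T f = head T e"
      by (auto elim: rtranclE)
    have "card (in_arcs T (head T e)) = 1"
      using deg[OF head_in_verts[OF e]] in_e by (auto simp: in_degree_def simp del: in_in_arcs_conv)
    then have "e = f" using f in_e by (metis card_1_singletonE in_in_arcs_conv singletonD)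
    with f show ?thesis by simp
  qed
  have all: "(r, v) \<in> ?R\<^sup>*" if "v \<in> verts T" for v
    using conn[OF that] unfolding reachable_def
  proof (induction rule: rtrancl_on_induct)
    case (step u v)
    then have "(u, v) \<in> ?R \<or> (v, u) \<in> ?R"
      by (auto simp: mk_symmetric_def symcl_def arcs_ends_def arc_to_ends_def parcs_mk_symmetric)
    with step.IH sym show ?case by (auto intro: rtrancl_into_rtrancl)
  qed simp
  have "\<exists>e\<in>arcs T. tail T e \<in> S \<and> head T e \<in> verts T - S" if S: "S \<subset> verts T" "r \<in> S" for S
  proof (rule ccontr)
    assume no: "\<not> ?thesis"
    have "v \<in> S" if "(r, v) \<in> ?R\<^sup>*" for v
      using that by (induction rule: rtrancl_induct) (use S no in auto)
    with all S show False by blast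
  qed
  with r show ?thesis by blast
qed

lemma rainbow_spanning_arborescence_exists:
  assumes "finite V" "V \<noteq> {}" "finite I"
    and arb: "\<And>i. i \<in> I \<Longrightarrow> spanning_arborescence_on V (A i)"
    and "card V \<le> card I + 1" "2 * card V \<le> card I + 4"
  shows "has_rainbow_spanning_arborescence V I A"
proof -
  let ?G = "arc_disjoint_union V I A"
  interpret coloured_arcs "tail ?G" "head ?G" fst .
  have "\<exists>r. root_connected V (arcs ?G) i r" if i: "i \<in> I" for i
  proof -
    have V: "verts (A i) = V" and "arborescence (A i)"
      using arb[OF i] by (auto simp: spanning_arborescence_on_def)
    then obtain r where r: "r \<in> V" and cut: "\<And>S. S \<subset> V \<Longrightarrow> r \<in> S \<Longrightarrow>
        \<exists>e\<in>arcs (A i). tail (A i) e \<in> S \<and> head (A i) e \<in> V - S"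
      using arborescence_cut[of "A i"] by auto
    have "\<exists>x\<in>arcs ?G. fst x = i \<and> tail ?G x \<in> S \<and> head ?G x \<in> V - S" if S: "S \<subset> V" "r \<in> S" for S
    proof -
      obtain e where "e \<in> arcs (A i)" "tail (A i) e \<in> S" "head (A i) e \<in> V - S"
        using cut[OF S] by blast
      then show ?thesis using i by (intro bexI[of _ "(i, e)"]) (auto simp: arc_disjoint_union_def)
    qed
    with r show ?thesis by (auto simp: root_connected_def)
  qed
  then obtain F where F: "rainbow_tree (arcs ?G) V F"
    using rainbow_tree_exists[of V I "arcs ?G"] assms by blast
  let ?B = "\<lparr>verts = V, arcs = F, tail = tail ?G, head = head ?G\<rparr>"
  have B: "spanning_arborescence_on V ?B" by (rule rainbow_tree_arborescence[OF F])
  have "wf_digraph (A i)" "verts (A i) = V" if "i \<in> I" for i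
    using arb[OF that] by (auto simp: spanning_arborescence_on_def arborescence_def)
  then have "wf_digraph ?G"
    by unfold_locales (auto simp: arc_disjoint_union_def dest: wf_digraph.tail_in_verts wf_digraph.head_in_verts)
  moreover have "wf_digraph ?B"
    using B by (simp add: spanning_arborescence_on_def arborescence_def)
  ultimately have "subgraph ?B ?G"
    using rainbow_tree_subset[OF F]
    by (auto simp: subgraph_def compatible_def arc_disjoint_union_def)
  moreover have "rainbow I A ?B"
    unfolding rainbow_def
  proof (intro ballI conjI)
    fix i assume "i \<in> I"
    have "finite F" using rainbow_tree_finite[OF F] by simp
    then show "finite (arcs ?B \<inter> ({i} \<times> arcs (A i)))" by simp
    then show "card (arcs ?B \<inter> ({i} \<times> arcs (A i))) \<le> 1"
      using rainbow_tree_inj_on_col[OF F] by (fastforce simp: card_le_Suc0_iff_eq inj_on_def)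
  qed
  ultimately show ?thesis using B unfolding has_rainbow_spanning_arborescence_def by blast
qed

theorem theorem4p1:
  fixes V :: "'a set" and n k :: nat and A :: "nat \<Rightarrow> ('a, 'b) pre_digraph"
  assumes "finite V" and "card V = n" and "n \<ge> 2"
    and "\<And>i. i \<in> {1..k} \<Longrightarrow> spanning_arborescence_on V (A i)"
  shows "(int k \<ge> 2 * int n - 3 \<longrightarrow> has_rainbow_spanning_arborescence V {1..k} A) \<and>
         (n \<ge> 3 \<and> int k \<ge> 2 * int n - 4 \<longrightarrow> has_rainbow_spanning_arborescence V {1..k} A)"
proof -
  \<comment> \<open>Either case implies both bounds: 2n - 3 \<ge> n - 1 for n \<ge> 2, and 2n - 4
    \<ge> n - 1 for n \<ge> 3.\<close>
  have "has_rainbow_spanning_arborescence V {1..k} A" if "n \<le> k + 1" "2 * n \<le> k + 4"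
    using assms that by (intro rainbow_spanning_arborescence_exists) auto
  then show ?thesis using assms(3) by auto
qed

end
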